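(* Let $\mathbb{P}$ be an $\omega$-poset. If $\mathbb{P}$ is weakly tangled then the spectrum $\mathsf{S}\mathbb{P}$ is hereditarily indecomposable. The converse holds if $\mathbb{P}$ is also regular and prime, i.e. if $\mathbb{P}$ is a regular prime $\omega$-poset and $\mathsf{S}\mathbb{P}$ is hereditarily indecomposable then $\mathbb{P}$ is weakly tangled.
   Context: Let $(\mathbb{P},\leq)$ be a poset. A subset $S\subseteq\mathbb{P}$ refines $T\subseteq\mathbb{P}$ if for every $s\in S$ there is $t\in T$ with $s\leq t$. A band of $\mathbb{P}$ is a finite subset $B\subseteq\mathbb{P}$ such that every $p\in\mathbb{P}$ is comparable to some $b\in B$. A cap of $\mathbb{P}$ is a subset refined by some band. A selector is a subset $S\subseteq\mathbb{P}$ with $S\cap C\neq\emptyset$ for every cap $C$ of $\mathbb{P}$; a minimal selector is one minimal with respect to inclusion among all selectors. The spectrum $\mathsf{S}\mathbb{P}$ is the set of all minimal selectors, with the topology generated by the subbasis consisting of the sets $p^\in=\{S\in\mathsf{S}\mathbb{P}:p\in S\}$, for $p\in\mathbb{P}$ (it is always a compact $T_1$ space). $\mathbb{P}$ is an $\omega$-poset if every principal filter $p^\leq=\{q\in\mathbb{P}:p\leq q\}$ is finite and, for each $n\in\omega$, the number of principal filters of size $n$ is finite. $\mathbb{P}$ is prime if every element of $\mathbb{P}$ lies in some minimal selector. For $p,q\in\mathbb{P}$ write $p\wedge q$ if there is $r\in\mathbb{P}$ with $r\leq p$ and $r\leq q$; for $A,B\subseteq\mathbb{P}$ write $A\wedge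 B$ if $a\wedge b$ for some $a\in A$ and $b\in B$. For $p\in\mathbb{P}$ and a cap $C$, the star of $p$ in $C$ is $Cp=\{c\in C:c\wedge p\}$. Write $p\vartriangleleft q$ if there is a cap $C$ of $\mathbb{P}$ such that $c\leq q$ for all $c\in Cp$. The poset $\mathbb{P}$ is regular if for every cap $D$ of $\mathbb{P}$ there is a cap $C$ of $\mathbb{P}$ such that for each $c\in C$ there is $d\in D$ with $c\vartriangleleft d$. A subset $E\subseteq\mathbb{P}$ is a cluster if $A\wedge B$ whenever $A\neq\emptyset\neq B$ and $A\cup B=E$. For $D,B\subseteq\mathbb{P}$ let $D^{\leq_B\geq}$ be the set of all $p\in\mathbb{P}$ for which there are $d\in D$ and $b\in B$ with $d\leq b$ and $p\leq b$. A refinement $A\subseteq\mathbb{P}$ of $B\subseteq\mathbb{P}$ is weakly tangled if, for all clusters $C,D\subseteq A$ with $C\cap D\neq\emptyset$, either $C\subseteq D^{\leq_B\geq}$ or $D\subseteq C^{\leq_B\geq}$. The poset $\mathbb{P}$ is weakly tangled if for every cap $C$ of $\mathbb{P}$ there is a cap $D$ of $\mathbb{P}$ which is a weakly tangled refinement of $C$. For a compact space $X$, a subcontinuum is a closed connected subset $Y\subseteq X$. A space is indecomposable if it is not the union of two proper subcontinua, and $X$ is hereditarily indecomposable if every subcontinuum of $X$ is indecomposable ($X$ itself is not required to be connected); equivalently, any two intersecting subcontinua of $X$ are comparable with respect to inclusion. *)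

theory Defs
  imports "HOL-Analysis.Analysis"
begin

section \<open>Posets, caps and selectors\<close>

text \<open>
  A poset is an arbitrary, possibly empty, set \<open>P\<close> with a partial order \<open>R\<close> on it.
  The library notion \<open>partial_order_on\<close> includes \<open>R \<subseteq> P \<times> P\<close>, so \<open>p \<sqsubseteq> q\<close> implies
  that both \<open>p\<close> and \<open>q\<close> belong to \<open>P\<close>.
\<close>

locale poset =
  fixes P :: "'a set" and R :: "'a rel"
  assumes partial_order: "partial_order_on P R"
begin

abbreviation le :: "'a \<Rightarrow> 'a \<Rightarrow> bool" (infix "\<sqsubseteq>" 50) where
  "p \<sqsubseteq> q \<equiv> (p, q) \<in> R"

definition refines :: "'a set \<Rightarrow> 'a set \<Rightarrow> bool" where
  "refines S T \<longleftrightarrow> (\<forall>s\<in>S. \<exists>t\<in>T. s \<sqsubseteq> t)"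

definition band :: "'a set \<Rightarrow> bool" where
  "band B \<longleftrightarrow> finite B \<and> B \<subseteq> P \<and> (\<forall>p\<in>P. \<exists>b\<in>B. p \<sqsubseteq> b \<or> b \<sqsubseteq> p)"

definition cap :: "'a set \<Rightarrow> bool" where
  "cap C \<longleftrightarrow> C \<subseteq> P \<and> (\<exists>B. band B \<and> refines B C)"

definition selector :: "'a set \<Rightarrow> bool" where
  "selector S \<longleftrightarrow> S \<subseteq> P \<and> (\<forall>C. cap C \<longrightarrow> S \<inter> C \<noteq> {})"

definition minimal_selector :: "'a set \<Rightarrow> bool" where
  "minimal_selector S \<longleftrightarrow> selector S \<and> (\<forall>T. selector T \<and> T \<subseteq> S \<longrightarrow> T = S)"

section \<open>The spectrum\<close>

definition spectrum :: "'a set set" where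
  "spectrum = {S. minimal_selector S}"

definition subbasic :: "'a \<Rightarrow> 'a set set" where
  "subbasic p = {S \<in> spectrum. p \<in> S}"

text \<open>
  \<open>topology_generated_by\<close> takes the union of the generators as the underlying space.
  Adding \<open>spectrum\<close> itself (the empty intersection of subbasic sets) to the generators
  makes it the underlying space for every poset.
\<close>

definition spectrum_topology :: "'a set topology" where
  "spectrum_topology = topology_generated_by (insert spectrum (subbasic ` P))"

lemma topspace_spectrum_topology [simp]: "topspace spectrum_topology = spectrum"
  by (auto simp: spectrum_topology_def subbasic_def)

section \<open>Classes of posets\<close>

definition principal_filter :: "'a \<Rightarrow> 'a set" where
  "principal_filter p = {q \<in> P. p \<sqsubseteq> q}"

definition omega :: bool where
  "omega \<longleftrightarrow> (\<forall>p\<in>P. finite (principal_filter p)) \<and>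
             (\<forall>n. finite {F \<in> principal_filter ` P. card F = n})"

definition prime_poset :: bool where
  "prime_poset \<longleftrightarrow> (\<forall>p\<in>P. \<exists>S. minimal_selector S \<and> p \<in> S)"

definition meets :: "'a \<Rightarrow> 'a \<Rightarrow> bool" where
  "meets p q \<longleftrightarrow> (\<exists>r\<in>P. r \<sqsubseteq> p \<and> r \<sqsubseteq> q)"

definition set_meets :: "'a set \<Rightarrow> 'a set \<Rightarrow> bool" where
  "set_meets A B \<longleftrightarrow> (\<exists>a\<in>A. \<exists>b\<in>B. meets a b)"

definition star :: "'a set \<Rightarrow> 'a \<Rightarrow> 'a set" where
  "star C p = {c \<in> C. meets c p}"

definition star_below :: "'a \<Rightarrow> 'a \<Rightarrow> bool" (infix "\<lhd>" 50) where
  "p \<lhd> q \<longleftrightarrow> (\<exists>C. cap C \<and> (\<forall>c\<in>star C p. c \<sqsubseteq> q))"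

definition regular_poset :: bool where
  "regular_poset \<longleftrightarrow> (\<forall>D. cap D \<longrightarrow> (\<exists>C. cap C \<and> (\<forall>c\<in>C. \<exists>d\<in>D. c \<lhd> d)))"

section \<open>Weakly tangled posets\<close>

definition cluster :: "'a set \<Rightarrow> bool" where
  "cluster E \<longleftrightarrow> E \<subseteq> P \<and>
     (\<forall>A B. A \<noteq> {} \<and> B \<noteq> {} \<and> A \<union> B = E \<longrightarrow> set_meets A B)"

text \<open>\<open>spread D B\<close> is the set written $D^{\leq_B\geq}$.\<close>

definition spread :: "'a set \<Rightarrow> 'a set \<Rightarrow> 'a set" where
  "spread D B = {p \<in> P. \<exists>d\<in>D. \<exists>b\<in>B. d \<sqsubseteq> b \<and> p \<sqsubseteq> b}"

definition weakly_tangled_refinement :: "'a set \<Rightarrow> 'a set \<Rightarrow> bool" where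
  "weakly_tangled_refinement A B \<longleftrightarrow> A \<subseteq> P \<and> B \<subseteq> P \<and> refines A B \<and>
     (\<forall>C D. cluster C \<and> cluster D \<and> C \<subseteq> A \<and> D \<subseteq> A \<and> C \<inter> D \<noteq> {} \<longrightarrow>
        C \<subseteq> spread D B \<or> D \<subseteq> spread C B)"

definition weakly_tangled :: bool where
  "weakly_tangled \<longleftrightarrow> (\<forall>C. cap C \<longrightarrow> (\<exists>D. cap D \<and> weakly_tangled_refinement D C))"

end

locale omega_poset = poset +
  assumes omega: "omega"

section \<open>Hereditarily indecomposable spaces\<close>

text \<open>
  The empty set counts as connected here, as in the library. This has no effect on
  (hereditary) indecomposability: a union of two proper subsets, one of them empty,
  is proper.
\<close>

definition subcontinuum :: "'b topology \<Rightarrow> 'b set \<Rightarrow> bool" where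
  "subcontinuum X Y \<longleftrightarrow> closedin X Y \<and> connectedin X Y"

definition indecomposable_space :: "'b topology \<Rightarrow> bool" where
  "indecomposable_space X \<longleftrightarrow>
     \<not> (\<exists>A B. subcontinuum X A \<and> A \<noteq> topspace X \<and>
              subcontinuum X B \<and> B \<noteq> topspace X \<and> A \<union> B = topspace X)"

definition hereditarily_indecomposable_space :: "'b topology \<Rightarrow> bool" where
  "hereditarily_indecomposable_space X \<longleftrightarrow>
     (\<forall>Y. subcontinuum X Y \<longrightarrow> indecomposable_space (subtopology X Y))"

end

theory Submission
  imports Defs
begin

text \<open>
  Write \<open>p\<^sup>\<in>\<close> for the basic open set \<open>subbasic p\<close> of all points of the spectrum that contain \<open>p\<close>,
  and say that \<open>p\<close> touches a set \<open>K\<close> of points if \<open>p\<^sup>\<in>\<close> meets \<open>K\<close>.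
  Three facts translate between an \<open>\<omega>\<close>-poset and its spectrum. A set \<open>C\<close> is a cap exactly
  when the sets \<open>c\<^sup>\<in>\<close> with \<open>c \<in> C\<close> cover the spectrum (\<open>cap_iff_covers\<close>); any two caps have a
  common refinement, because the levels of the poset are cofinal among the caps
  (\<open>cap_refined_by_levels\<close>); hence the points are filters and the sets \<open>p\<^sup>\<in>\<close> form a basis
  (\<open>openin_spectrum_iff\<close>). On the topological side, hereditary indecomposability is used in the
  form that intersecting subcontinua are comparable (\<open>hereditarily_indecomposable_space_iff\<close>).

  Weakly tangled implies hereditarily indecomposable: let \<open>K\<close> and \<open>L\<close> be intersecting
  subcontinua with \<open>x \<in> K - L\<close> and \<open>y \<in> L - K\<close>. There is a cap \<open>C\<close> so fine that no element of
  \<open>C\<close> belonging to \<open>x\<close> touches \<open>L\<close> and no element belonging to \<open>y\<close> touches \<open>K\<close>. For every cap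
  \<open>D\<close>, the elements of \<open>D\<close> that touch \<open>K\<close> form a cluster since \<open>K\<close> is connected, and likewise for
  \<open>L\<close>; the two clusters share an element. If \<open>D\<close> is a weakly tangled refinement of \<open>C\<close>, then, say,
  an element of \<open>D\<close> belonging to \<open>x\<close> lies together with one touching \<open>L\<close> below some \<open>c \<in> C\<close>; this
  \<open>c\<close> belongs to \<open>x\<close> and touches \<open>L\<close>, contrary to the choice of \<open>C\<close>.

  The converse is a limit argument. If a cap \<open>C\<close> has no weakly tangled refinement, then every
  sufficiently high level \<open>n\<close> contains clusters \<open>E n\<close> and \<open>F n\<close> that share an element and violate
  the condition. Along a free ultrafilter \<open>E\<close> and \<open>F\<close> have limits \<open>K\<close> and \<open>L\<close> in the spectrum. These
  are closed, and in a regular prime poset, whose spectrum is compact Hausdorff, they are connected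
  (\<open>connectedin_limit_set\<close>). Elements \<open>e n\<close> of \<open>E n\<close> that are far from \<open>F n\<close>, as measured by
  \<open>C\<close>, have a limit (\<open>limit_point\<close>) in \<open>K - L\<close>; in the same way one finds points in \<open>L - K\<close>
  and in \<open>K \<inter> L\<close>. So \<open>K\<close> and \<open>L\<close> are intersecting incomparable subcontinua.
\<close>

section \<open>Intersecting subcontinua\<close>

lemma subcontinuum_subtopology_closed:
  assumes "closedin X Y"
  shows "subcontinuum (subtopology X Y) A \<longleftrightarrow> subcontinuum X A \<and> A \<subseteq> Y"
  using assms by (auto simp: subcontinuum_def closedin_closed_subtopology connectedin_subtopology)

text \<open>
  A decomposition of a connected space into two proper subcontinua consists of two
  intersecting incomparable ones, and conversely two such subcontinua decompose their union.
\<close>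

lemma hereditarily_indecomposable_space_iff:
  "hereditarily_indecomposable_space X \<longleftrightarrow>
     (\<forall>K L. subcontinuum X K \<and> subcontinuum X L \<and> K \<inter> L \<noteq> {} \<longrightarrow> K \<subseteq> L \<or> L \<subseteq> K)"
  (is "_ \<longleftrightarrow> ?comparable")
proof
  assume hi: "hereditarily_indecomposable_space X"
  show ?comparable
  proof (intro allI impI)
    fix K L
    assume KL: "subcontinuum X K \<and> subcontinuum X L \<and> K \<inter> L \<noteq> {}"
    then have Y: "subcontinuum X (K \<union> L)"
      by (auto simp: subcontinuum_def closedin_Un connectedin_Un)
    then have top: "topspace (subtopology X (K \<union> L)) = K \<union> L"
      by (auto simp: subcontinuum_def dest: closedin_subset)
    have "indecomposable_space (subtopology X (K \<union> L))"
      using hi Y by (simp add: hereditarily_indecomposable_space_def)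
    moreover have "subcontinuum (subtopology X (K \<union> L)) K" "subcontinuum (subtopology X (K \<union> L)) L"
      using KL Y subcontinuum_subtopology_closed[of X "K \<union> L"]
      by (simp_all add: subcontinuum_def)
    ultimately have "K = K \<union> L \<or> L = K \<union> L"
      unfolding indecomposable_space_def top by blast
    then show "K \<subseteq> L \<or> L \<subseteq> K" by blast
  qed
next
  assume cmp: ?comparable
  show "hereditarily_indecomposable_space X"
    unfolding hereditarily_indecomposable_space_def indecomposable_space_def
  proof (intro allI impI notI)
    fix Y
    assume Y: "subcontinuum X Y"
    then have clY: "closedin X Y" and conY: "connectedin X Y" by (auto simp: subcontinuum_def)
    then have top: "topspace (subtopology X Y) = Y"
      by (auto dest: closedin_subset)
    assume "\<exists>A B. subcontinuum (subtopology X Y) A \<and> A \<noteq> topspace (subtopology X Y) \<and>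
              subcontinuum (subtopology X Y) B \<and> B \<noteq> topspace (subtopology X Y) \<and>
              A \<union> B = topspace (subtopology X Y)"
    then obtain A B where A: "subcontinuum X A" "A \<noteq> Y" and B: "subcontinuum X B" "B \<noteq> Y"
      and AB: "A \<union> B = Y"
      unfolding top subcontinuum_subtopology_closed[OF clY] by blast
    have "A \<inter> B \<noteq> {}"
    proof
      assume "A \<inter> B = {}"
      moreover have "A \<inter> Y \<noteq> {}" "B \<inter> Y \<noteq> {}"
        using A(2) B(2) AB by blast+
      moreover have "closedin X A" "closedin X B"
        using A(1) B(1) by (simp_all add: subcontinuum_def)
      ultimately show False
        using conY AB unfolding connectedin_closedin by blast
    qed
    then have "A \<subseteq> B \<or> B \<subseteq> A"
      using cmp A(1) B(1) by blast
    then show False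
      using A(2) B(2) AB by blast
  qed
qed

section \<open>Ultrafilters\<close>

definition ultrafilter :: "'b filter \<Rightarrow> bool" where
  "ultrafilter U \<longleftrightarrow> U \<noteq> bot \<and> (\<forall>Q. eventually Q U \<or> eventually (\<lambda>x. \<not> Q x) U)"

lemma ultrafilter_not_eventually:
  "ultrafilter U \<Longrightarrow> \<not> eventually Q U \<Longrightarrow> eventually (\<lambda>x. \<not> Q x) U"
  by (auto simp: ultrafilter_def)

lemma ultrafilter_bex_finite:
  assumes U: "ultrafilter U" and "finite A" and ev: "\<forall>\<^sub>F x in U. \<exists>a\<in>A. Q x a"
  shows "\<exists>a\<in>A. \<forall>\<^sub>F x in U. Q x a"
proof (rule ccontr)
  assume "\<not> ?thesis"
  then have "\<forall>a\<in>A. \<forall>\<^sub>F x in U. \<not> Q x a"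
    using ultrafilter_not_eventually[OF U] by blast
  then have "\<forall>\<^sub>F x in U. \<forall>a\<in>A. \<not> Q x a"
    using \<open>finite A\<close> by (simp add: eventually_ball_finite)
  with ev have "\<forall>\<^sub>F x in U. False"
    by eventually_elim blast
  with U show False by (simp add: ultrafilter_def)
qed

text \<open>
  Finer filters are smaller in the order on filters, so an ultrafilter is a minimal
  proper filter, and Zorn's lemma is applied to the reversed order.
\<close>

lemma ultrafilter_exists:
  fixes F :: "'b filter"
  assumes F: "F \<noteq> bot"
  obtains U where "ultrafilter U" "U \<le> F"
proof -
  let ?\<F> = "{G. G \<noteq> bot \<and> G \<le> F}"
  let ?r = "relation_of (\<lambda>G H. H \<le> G) ?\<F>"
  have "partial_order_on ?\<F> ?r"
    by (rule partial_order_on_relation_ofI) auto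
  moreover have "\<exists>u\<in>?\<F>. \<forall>G\<in>\<C>. u \<le> G" if ch: "\<C> \<in> Chains ?r" for \<C>
  proof (cases "\<C> = {}")
    case True
    then show ?thesis using F by blast
  next
    case False
    have total: "G \<le> H \<or> H \<le> G" if "G \<in> \<C>" "H \<in> \<C>" for G H
      using ch that unfolding Chains_def relation_of_def by auto
    have sub: "\<C> \<subseteq> ?\<F>"
      using ch unfolding Chains_def relation_of_def by auto
    have "eventually (\<lambda>_. False) (Inf \<C>) \<longleftrightarrow> (\<exists>G\<in>\<C>. eventually (\<lambda>_. False) G)"
    proof (rule eventually_Inf_base[OF False])
      fix G H assume "G \<in> \<C>" "H \<in> \<C>"
      then show "\<exists>x\<in>\<C>. x \<le> inf G H"
        using total[of G H] by (auto simp: le_inf_iff)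
    qed
    then have "Inf \<C> \<noteq> bot"
      using sub by (auto simp: trivial_limit_def)
    moreover obtain G where G: "G \<in> \<C>"
      using False by blast
    then have "Inf \<C> \<le> F"
      using sub by (intro Inf_lower2[OF G]) auto
    ultimately show ?thesis
      by (intro bexI[of _ "Inf \<C>"]) (auto intro: Inf_lower)
  qed
  ultimately have "\<exists>U\<in>?\<F>. \<forall>G\<in>?\<F>. G \<le> U \<longrightarrow> G = U"
    by (rule predicate_Zorn)
  then obtain U where U: "U \<noteq> bot" "U \<le> F"
    and min: "\<And>G. G \<noteq> bot \<Longrightarrow> G \<le> F \<Longrightarrow> G \<le> U \<Longrightarrow> G = U"
    by blast
  have "eventually (\<lambda>x. \<not> Q x) U" if "\<not> eventually Q U" for Q
  proof -
    let ?G = "inf U (principal {x. \<not> Q x})"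
    have "?G \<noteq> bot"
      using that by (simp add: trivial_limit_def eventually_inf_principal)
    then have eq: "?G = U"
      using U(2) by (intro min) (auto intro: le_infI1)
    have "eventually (\<lambda>x. \<not> Q x) ?G"
      by (simp add: eventually_inf_principal)
    then show ?thesis
      unfolding eq .
  qed
  with U that show thesis by (auto simp: ultrafilter_def)
qed

section \<open>Caps and minimal selectors\<close>

context poset
begin

lemma le_carrier: "p \<sqsubseteq> q \<Longrightarrow> p \<in> P \<and> q \<in> P"
  using partial_order by (auto simp: partial_order_on_def preorder_on_def)

lemma le_refl: "p \<in> P \<Longrightarrow> p \<sqsubseteq> p"
  using partial_order by (auto simp: partial_order_on_def preorder_on_def refl_on_def)

lemma le_trans: "p \<sqsubseteq> q \<Longrightarrow> q \<sqsubseteq> r \<Longrightarrow> p \<sqsubseteq> r"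
  using partial_order by (auto simp: partial_order_on_def preorder_on_def dest: transD)

lemma le_antisym: "p \<sqsubseteq> q \<Longrightarrow> q \<sqsubseteq> p \<Longrightarrow> p = q"
  using partial_order by (auto simp: partial_order_on_def dest: antisymD)

lemma refines_trans: "refines A B \<Longrightarrow> refines B C \<Longrightarrow> refines A C"
  unfolding refines_def by (meson le_trans)

lemma refines_subset: "A \<subseteq> B \<Longrightarrow> A \<subseteq> P \<Longrightarrow> refines A B"
  unfolding refines_def using le_refl by blast

lemma cap_if_refined: "cap C \<Longrightarrow> refines C D \<Longrightarrow> D \<subseteq> P \<Longrightarrow> cap D"
  unfolding cap_def by (meson refines_trans)

lemma cap_mono: "cap C \<Longrightarrow> C \<subseteq> D \<Longrightarrow> D \<subseteq> P \<Longrightarrow> cap D"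
  by (meson cap_if_refined order_trans refines_subset)

lemma cap_subset: "cap C \<Longrightarrow> C \<subseteq> P"
  by (simp add: cap_def)

lemma finite_subcap:
  assumes "cap C"
  obtains D where "D \<subseteq> C" "finite D" "cap D"
proof -
  obtain B where B: "band B" "refines B C" and CP: "C \<subseteq> P"
    using assms by (auto simp: cap_def)
  then obtain f where f: "\<forall>b\<in>B. f b \<in> C \<and> b \<sqsubseteq> f b"
    unfolding refines_def by metis
  then have "refines B (f ` B)"
    by (auto simp: refines_def)
  then show thesis
    using that[of "f ` B"] B f CP by (auto simp: cap_def band_def)
qed

lemma selector_iff: "selector S \<longleftrightarrow> S \<subseteq> P \<and> \<not> cap (P - S)"
  unfolding selector_def by (metis Diff_disjoint Diff_subset cap_mono cap_subset disjoint_iff DiffI subsetD subsetI)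

text \<open>
  Selectors are the complements of the sets that are not caps. As every cap contains a finite
  cap, a union of a chain of non-caps is not a cap, so every non-cap extends to a maximal one.
\<close>

lemma selector_contains_minimal:
  assumes S: "selector S"
  obtains M where "M \<in> spectrum" "M \<subseteq> S"
proof -
  let ?N = "{N. P - S \<subseteq> N \<and> N \<subseteq> P \<and> \<not> cap N}"
  have "P - S \<in> ?N"
    using S by (auto simp: selector_iff)
  then have "?N \<noteq> {}" by blast
  moreover have "\<Union>\<C> \<in> ?N" if "\<C> \<noteq> {}" and ch: "subset.chain ?N \<C>" for \<C>
  proof -
    have sub: "\<C> \<subseteq> ?N"
      using ch by (auto simp: subset.chain_def)
    have "\<not> cap (\<Union>\<C>)"
    proof
      assume "cap (\<Union>\<C>)"
      then obtain D where D: "D \<subseteq> \<Union>\<C>" "finite D" "cap D"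
        by (rule finite_subcap)
      then obtain N where "N \<in> \<C>" "D \<subseteq> N"
        using \<open>\<C> \<noteq> {}\<close> ch finite_subset_Union_chain by metis
      with D(3) sub cap_mono[of D N] show False by auto
    qed
    with sub \<open>\<C> \<noteq> {}\<close> show ?thesis by blast
  qed
  ultimately have "\<exists>N\<in>?N. \<forall>X\<in>?N. N \<subseteq> X \<longrightarrow> X = N"
    by (rule subset_Zorn_nonempty)
  then obtain N where N: "N \<in> ?N" and max: "\<forall>X\<in>?N. N \<subseteq> X \<longrightarrow> X = N"
    by (rule bexE)
  have "minimal_selector (P - N)"
    unfolding minimal_selector_def
  proof (intro conjI allI impI)
    show "selector (P - N)"
      using N by (auto simp: selector_iff double_diff)
    fix T assume T: "selector T \<and> T \<subseteq> P - N"
    then have "P - T = N"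
      using N by (intro max[rule_format]) (auto simp: selector_iff)
    with T show "T = P - N"
      by (auto simp: selector_iff)
  qed
  with N that[of "P - N"] show thesis
    by (auto simp: spectrum_def)
qed

lemma spectrum_carrier: "S \<in> spectrum \<Longrightarrow> S \<subseteq> P"
  by (auto simp: spectrum_def minimal_selector_def selector_def)

lemma spectrum_meets_cap: "S \<in> spectrum \<Longrightarrow> cap C \<Longrightarrow> \<exists>c\<in>C. c \<in> S"
  by (auto simp: spectrum_def minimal_selector_def selector_def)

lemma spectrum_unique_in_cap:
  assumes "S \<in> spectrum" "p \<in> S"
  obtains C where "cap C" "S \<inter> C = {p}"
proof -
  have "\<not> selector (S - {p})"
    using assms unfolding spectrum_def minimal_selector_def by blast
  then obtain C where C: "cap C" "(S - {p}) \<inter> C = {}"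
    using spectrum_carrier[OF assms(1)] unfolding selector_def by blast
  moreover have "S \<inter> C \<noteq> {}"
    using C(1) assms(1) spectrum_meets_cap by blast
  ultimately show thesis
    using that[of C] by blast
qed

text \<open>
  If \<open>p\<close> is the only element of \<open>S\<close> in a cap, replacing \<open>p\<close> by a larger \<open>q\<close> leaves a cap, and
  \<open>S\<close> can only meet it in \<open>q\<close>.
\<close>

lemma spectrum_up_closed:
  assumes S: "S \<in> spectrum" and p: "p \<in> S" and "p \<sqsubseteq> q"
  shows "q \<in> S"
proof -
  obtain C where C: "cap C" "S \<inter> C = {p}"
    using spectrum_unique_in_cap[OF S p] by blast
  have "refines C (insert q (C - {p}))"
    using \<open>p \<sqsubseteq> q\<close> cap_subset[OF C(1)] le_refl by (auto simp: refines_def)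
  then have "cap (insert q (C - {p}))"
    using C(1) cap_subset[OF C(1)] le_carrier[OF \<open>p \<sqsubseteq> q\<close>] by (auto intro: cap_if_refined)
  then obtain c where "c \<in> insert q (C - {p})" "c \<in> S"
    using S spectrum_meets_cap by blast
  with C(2) show ?thesis by blast
qed

lemma spectrum_incomparable:
  assumes "S \<in> spectrum" "T \<in> spectrum" "S \<noteq> T"
  obtains p where "p \<in> S" "p \<notin> T"
  using assms unfolding spectrum_def minimal_selector_def by blast

lemma subbasic_mono: "p \<sqsubseteq> q \<Longrightarrow> subbasic p \<subseteq> subbasic q"
  using spectrum_up_closed by (auto simp: subbasic_def)

text \<open>A set that is not a cap misses a selector, hence a point of the spectrum.\<close>

lemma cap_iff_covers:
  assumes "C \<subseteq> P"
  shows "cap C \<longleftrightarrow> (\<forall>S\<in>spectrum. \<exists>c\<in>C. c \<in> S)"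
proof
  assume cov: "\<forall>S\<in>spectrum. \<exists>c\<in>C. c \<in> S"
  show "cap C"
  proof (rule ccontr)
    assume "\<not> cap C"
    then have "selector (P - C)"
      using assms by (auto simp: selector_iff double_diff)
    then obtain M where "M \<in> spectrum" "M \<subseteq> P - C"
      by (rule selector_contains_minimal)
    with cov show False by blast
  qed
qed (use spectrum_meets_cap in blast)

end

section \<open>Levels of an \<open>\<omega>\<close>-poset\<close>

context omega_poset
begin

text \<open>
  The elements of rank less than \<open>n\<close>, where the rank of \<open>p\<close> is the largest number of steps in
  a strictly increasing chain that starts at \<open>p\<close>.
\<close>

primrec upper :: "nat \<Rightarrow> 'a set" where
  "upper 0 = {}"
| "upper (Suc n) = {p \<in> P. \<forall>q. p \<sqsubseteq> q \<and> q \<noteq> p \<longrightarrow> q \<in> upper n}"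

definition level :: "nat \<Rightarrow> 'a set" where
  "level n = {p \<in> upper (Suc n). \<forall>q\<in>upper (Suc n). q \<sqsubseteq> p \<longrightarrow> q = p}"

lemma finite_principal_filter: "p \<in> P \<Longrightarrow> finite (principal_filter p)"
  using omega by (simp add: omega_def)

lemma principal_filter_psubset:
  assumes "p \<sqsubseteq> q" "q \<noteq> p"
  shows "principal_filter q \<subset> principal_filter p"
proof -
  have "principal_filter q \<subseteq> principal_filter p"
    using le_trans[OF assms(1)] by (auto simp: principal_filter_def)
  moreover have "p \<in> principal_filter p" "p \<notin> principal_filter q"
    using assms le_refl[of p] le_carrier[OF assms(1)] le_antisym[of p q]
    by (auto simp: principal_filter_def)
  ultimately show ?thesis by blast
qed

lemma card_principal_filter_less:
  "p \<sqsubseteq> q \<Longrightarrow> q \<noteq> p \<Longrightarrow> card (principal_filter q) < card (principal_filter p)"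
  by (meson finite_principal_filter le_carrier principal_filter_psubset psubset_card_mono)

lemma finite_card_principal_filter_le: "finite {p \<in> P. card (principal_filter p) \<le> k}" (is "finite ?A")
proof -
  have "principal_filter ` ?A \<subseteq> (\<Union>i\<le>k. {F \<in> principal_filter ` P. card F = i})"
    by auto
  moreover have "finite (\<Union>i\<le>k. {F \<in> principal_filter ` P. card F = i})"
    using omega by (simp add: omega_def)
  ultimately have "finite (principal_filter ` ?A)"
    by (rule finite_subset)
  moreover have "inj_on principal_filter ?A"
  proof (rule inj_onI)
    fix p q assume pq: "p \<in> ?A" "q \<in> ?A" and eq: "principal_filter p = principal_filter q"
    then have "p \<in> principal_filter q" "q \<in> principal_filter p"
      using le_refl by (auto simp: principal_filter_def)
    then show "p = q"
      by (auto simp: principal_filter_def intro: le_antisym)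
  qed
  ultimately show ?thesis
    by (rule finite_imageD)
qed

lemma upper_carrier: "upper n \<subseteq> P"
  by (cases n) auto

lemma finite_upper: "finite (upper n)"
proof (induction n)
  case (Suc n)
  have "card (principal_filter p) \<le> Suc (card (upper n))" if "p \<in> upper (Suc n)" for p
  proof -
    have "principal_filter p \<subseteq> insert p (upper n)"
      using that by (auto simp: principal_filter_def)
    then have "card (principal_filter p) \<le> card (insert p (upper n))"
      using Suc by (intro card_mono) auto
    also have "\<dots> \<le> Suc (card (upper n))"
      by (rule card_insert_le_m1) auto
    finally show ?thesis .
  qed
  then have "upper (Suc n) \<subseteq> {p \<in> P. card (principal_filter p) \<le> Suc (card (upper n))}"
    by auto
  then show ?case
    using finite_card_principal_filter_le by (rule finite_subset)
qed simp

lemma upper_Suc: "upper n \<subseteq> upper (Suc n)"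
  by (induction n) auto

lemma upper_mono: "m \<le> n \<Longrightarrow> upper m \<subseteq> upper n"
  using upper_Suc by (rule lift_Suc_mono_le)

lemma mem_upper: "p \<in> P \<Longrightarrow> p \<in> upper (card (principal_filter p))"
proof (induction "card (principal_filter p)" arbitrary: p rule: less_induct)
  case less
  have "p \<in> principal_filter p"
    using less.prems le_refl by (simp add: principal_filter_def)
  then obtain k where k: "card (principal_filter p) = Suc k"
    using finite_principal_filter[OF less.prems] by (metis card_gt_0_iff empty_iff gr0_implies_Suc)
  have "q \<in> upper k" if "p \<sqsubseteq> q" "q \<noteq> p" for q
    using less.hyps[of q] card_principal_filter_less[OF that] le_carrier[OF that(1)]
      upper_mono[of "card (principal_filter q)" k] k by auto
  then show ?case
    using less.prems k by simp
qed

lemma above_rank_exactly: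
  assumes "p \<in> P" "p \<notin> upper n"
  shows "\<exists>q\<in>upper (Suc n) - upper n. p \<sqsubseteq> q"
  using assms
proof (induction "card (principal_filter p)" arbitrary: p rule: less_induct)
  case less
  show ?case
  proof (cases "p \<in> upper (Suc n)")
    case True
    then show ?thesis using less.prems le_refl by blast
  next
    case False
    then obtain q where q: "p \<sqsubseteq> q" "q \<noteq> p" "q \<notin> upper n"
      using less.prems(1) by auto
    then show ?thesis
      using less.hyps[of q] card_principal_filter_less le_carrier le_trans by blast
  qed
qed

lemma above_level:
  assumes "p \<in> upper (Suc n)"
  shows "\<exists>q\<in>level n. q \<sqsubseteq> p"
  using assms
proof (induction "card {q \<in> upper (Suc n). q \<sqsubseteq> p}" arbitrary: p rule: less_induct)
  case less
  show ?case
  proof (cases "p \<in> level n")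
    case True
    then show ?thesis using less.prems le_refl upper_carrier by blast
  next
    case False
    then obtain r where r: "r \<in> upper (Suc n)" "r \<sqsubseteq> p" "r \<noteq> p"
      using less.prems unfolding level_def by blast
    have "{q \<in> upper (Suc n). q \<sqsubseteq> r} \<subset> {q \<in> upper (Suc n). q \<sqsubseteq> p}"
      using r less.prems le_trans le_antisym le_carrier le_refl by blast
    then have "card {q \<in> upper (Suc n). q \<sqsubseteq> r} < card {q \<in> upper (Suc n). q \<sqsubseteq> p}"
      using finite_upper[of "Suc n"] by (intro psubset_card_mono finite_Collect_conjI) simp_all
    then show ?thesis
      using less.hyps r le_trans by blast
  qed
qed

text \<open>
  An element of rank at most \<open>n\<close> lies above a minimal element of \<open>upper (Suc n)\<close>. Every other
  element lies below one of rank exactly \<open>n\<close>, which is minimal in \<open>upper (Suc n)\<close> as well.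
\<close>

lemma band_level: "band (level n)"
  unfolding band_def
proof (intro conjI ballI)
  show "finite (level n)"
    using finite_upper[of "Suc n"] by (auto simp: level_def simp del: upper.simps)
  show "level n \<subseteq> P"
    by (auto simp: level_def)
  fix p assume p: "p \<in> P"
  show "\<exists>b\<in>level n. p \<sqsubseteq> b \<or> b \<sqsubseteq> p"
  proof (cases "p \<in> upper (Suc n)")
    case True
    then show ?thesis using above_level by blast
  next
    case False
    then have "p \<notin> upper n"
      using upper_Suc by blast
    then obtain q where q: "q \<in> upper (Suc n)" "q \<notin> upper n" "p \<sqsubseteq> q"
      using above_rank_exactly[OF p] by blast
    then have "q \<in> level n"
      by (auto simp: level_def)
    with q show ?thesis by blast
  qed
qed

lemma level_carrier: "level n \<subseteq> P"
  using band_level by (simp add: band_def)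

lemma cap_level: "cap (level n)"
  using band_level level_carrier refines_subset[of "level n" "level n"] by (auto simp: cap_def)

text \<open>
  Once \<open>upper (Suc m)\<close> contains a band \<open>B\<close>, no element of level \<open>m\<close> lies strictly above an
  element of \<open>B\<close>, so comparability with \<open>B\<close> puts it below an element of \<open>B\<close>.
\<close>

lemma cap_refined_by_levels:
  assumes "cap C"
  shows "\<exists>n. \<forall>m\<ge>n. refines (level m) C"
proof -
  obtain B where B: "band B" "refines B C"
    using assms by (auto simp: cap_def)
  let ?n = "Max (insert 0 ((\<lambda>b. card (principal_filter b)) ` B))"
  have "refines (level m) B" if m: "m \<ge> ?n" for m
    unfolding refines_def
  proof
    have Bup: "b \<in> upper (Suc m)" if "b \<in> B" for b
    proof -
      have "card (principal_filter b) \<le> ?n"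
        using B(1) that by (intro Max_ge) (auto simp: band_def)
      then show ?thesis
        using mem_upper[of b] upper_mono[of "card (principal_filter b)" "Suc m"] m B(1) that
        unfolding band_def by (meson le_SucI order_trans subsetD)
    qed
    fix p assume p: "p \<in> level m"
    then obtain b where b: "b \<in> B" "p \<sqsubseteq> b \<or> b \<sqsubseteq> p"
      using B(1) level_carrier unfolding band_def by blast
    then have "p \<sqsubseteq> b"
      using p Bup[OF b(1)] unfolding level_def by blast
    with b(1) show "\<exists>b\<in>B. p \<sqsubseteq> b" by blast
  qed
  with B(2) show ?thesis
    by (meson refines_trans)
qed

lemma common_refinement:
  assumes "cap C" "cap D"
  obtains E where "cap E" "refines E C" "refines E D"
  using cap_refined_by_levels[OF assms(1)] cap_refined_by_levels[OF assms(2)] cap_level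
  by (metis nle_le)

section \<open>The topology of the spectrum\<close>

lemma spectrum_directed:
  assumes S: "S \<in> spectrum" and p: "p \<in> S" and q: "q \<in> S"
  shows "\<exists>r\<in>S. r \<sqsubseteq> p \<and> r \<sqsubseteq> q"
proof -
  obtain C D where C: "cap C" "S \<inter> C = {p}" and D: "cap D" "S \<inter> D = {q}"
    using spectrum_unique_in_cap[OF S p] spectrum_unique_in_cap[OF S q] by metis
  then obtain E where E: "cap E" "refines E C" "refines E D"
    using common_refinement by metis
  then obtain r where r: "r \<in> E" "r \<in> S"
    using spectrum_meets_cap[OF S] by blast
  obtain c d where cd: "c \<in> C" "r \<sqsubseteq> c" "d \<in> D" "r \<sqsubseteq> d"
    using E r(1) unfolding refines_def by blast
  then have "c \<in> S \<inter> C" "d \<in> S \<inter> D"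
    using spectrum_up_closed[OF S r(2)] by blast+
  then have "c = p" "d = q"
    using C(2) D(2) by auto
  with cd r(2) show ?thesis by blast
qed

lemma meets_if_common_point: "S \<in> spectrum \<Longrightarrow> p \<in> S \<Longrightarrow> q \<in> S \<Longrightarrow> meets p q"
  unfolding meets_def using spectrum_directed spectrum_carrier by blast

lemma openin_subbasic: "p \<in> P \<Longrightarrow> openin spectrum_topology (subbasic p)"
  by (auto simp: spectrum_topology_def intro: topology_generated_by_Basis)

lemma openin_spectrum_iff:
  "openin spectrum_topology U \<longleftrightarrow> U \<subseteq> spectrum \<and> (\<forall>S\<in>U. \<exists>p\<in>S. subbasic p \<subseteq> U)"
proof
  assume U: "openin spectrum_topology U"
  then have "generate_topology_on (insert spectrum (subbasic ` P)) U"
    by (simp add: spectrum_topology_def openin_topology_generated_by_iff)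
  then have "\<forall>S\<in>U. \<exists>p\<in>S. subbasic p \<subseteq> U"
  proof (induction rule: generate_topology_on.induct)
    case (Int V W)
    show ?case
    proof
      fix S assume S: "S \<in> V \<inter> W"
      then obtain p q where p: "p \<in> S" "subbasic p \<subseteq> V" and q: "q \<in> S" "subbasic q \<subseteq> W"
        using Int by blast
      have "S \<in> spectrum"
        using S Int.hyps openin_subset[of spectrum_topology]
        by (auto simp: spectrum_topology_def openin_topology_generated_by_iff[symmetric] subbasic_def)
      then obtain r where "r \<in> S" "r \<sqsubseteq> p" "r \<sqsubseteq> q"
        using spectrum_directed p(1) q(1) by blast
      then show "\<exists>r\<in>S. subbasic r \<subseteq> V \<inter> W"
        using p(2) q(2) subbasic_mono by blast
    qed
  next
    case (Basis V)
    show ?case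
    proof
      fix S assume S: "S \<in> V"
      then have "S \<in> spectrum"
        using Basis by (auto simp: subbasic_def)
      then obtain p where "p \<in> S"
        using spectrum_meets_cap cap_level by blast
      then show "\<exists>p\<in>S. subbasic p \<subseteq> V"
        using Basis S by (auto simp: subbasic_def)
    qed
  next
    case (UN \<V>)
    show ?case
    proof
      fix S assume "S \<in> \<Union>\<V>"
      then obtain V where V: "V \<in> \<V>" "S \<in> V" by blast
      then obtain p where "p \<in> S" "subbasic p \<subseteq> V"
        using UN.IH by blast
      with V(1) show "\<exists>p\<in>S. subbasic p \<subseteq> \<Union>\<V>" by blast
    qed
  qed simp
  with openin_subset[OF U] show "U \<subseteq> spectrum \<and> (\<forall>S\<in>U. \<exists>p\<in>S. subbasic p \<subseteq> U)"
    by simp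
next
  assume U: "U \<subseteq> spectrum \<and> (\<forall>S\<in>U. \<exists>p\<in>S. subbasic p \<subseteq> U)"
  have "\<exists>V. openin spectrum_topology V \<and> S \<in> V \<and> V \<subseteq> U" if S: "S \<in> U" for S
  proof -
    obtain p where p: "p \<in> S" "subbasic p \<subseteq> U" using U S by blast
    then have "p \<in> P" "S \<in> subbasic p"
      using U S spectrum_carrier by (auto simp: subbasic_def)
    then show ?thesis using p openin_subbasic by blast
  qed
  then show "openin spectrum_topology U"
    by (subst openin_subopen) blast
qed

lemma spectrum_outside_closed:
  assumes "closedin spectrum_topology K" "S \<in> spectrum" "S \<notin> K"
  obtains p where "p \<in> S" "subbasic p \<inter> K = {}"
proof -
  have "openin spectrum_topology (spectrum - K)"
    using assms(1) by (simp add: closedin_def)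
  then show thesis
    using that assms(2,3) unfolding openin_spectrum_iff by blast
qed

text \<open>
  The \<open>p \<in> P\<close> whose basic set lies in a member of a given open cover form a cap, which
  contains a finite cap.
\<close>

lemma compact_space_spectrum: "compact_space spectrum_topology"
  unfolding compact_space_alt
proof (intro allI impI)
  fix \<U>
  assume "(\<forall>U\<in>\<U>. openin spectrum_topology U) \<and> topspace spectrum_topology \<subseteq> \<Union>\<U>"
  then have op: "\<forall>U\<in>\<U>. openin spectrum_topology U" and cov: "topspace spectrum_topology \<subseteq> \<Union>\<U>"
    by auto
  let ?C = "{p \<in> P. \<exists>U\<in>\<U>. subbasic p \<subseteq> U}"
  have "\<exists>p\<in>?C. p \<in> S" if S: "S \<in> spectrum" for S
  proof -
    obtain U where "U \<in> \<U>" "S \<in> U"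
      using cov S by auto
    then obtain p where "p \<in> S" "subbasic p \<subseteq> U"
      using op openin_spectrum_iff by blast
    with \<open>U \<in> \<U>\<close> show ?thesis
      using spectrum_carrier[OF S] by blast
  qed
  then have "cap ?C"
    by (simp add: cap_iff_covers)
  then obtain D where D: "D \<subseteq> ?C" "finite D" "cap D"
    by (rule finite_subcap)
  then obtain f where f: "\<forall>d\<in>D. f d \<in> \<U> \<and> subbasic d \<subseteq> f d"
    by (auto simp: subset_iff) metis
  have "spectrum \<subseteq> \<Union>(f ` D)"
  proof
    fix S assume "S \<in> spectrum"
    then obtain d where "d \<in> D" "S \<in> subbasic d"
      using spectrum_meets_cap D(3) by (auto simp: subbasic_def)
    with f show "S \<in> \<Union>(f ` D)" by blast
  qed
  with f D(2) show "\<exists>\<F>. finite \<F> \<and> \<F> \<subseteq> \<U> \<and> topspace spectrum_topology \<subseteq> \<Union>\<F>"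
    by (intro exI[of _ "f ` D"]) auto
qed

lemma star_below_point:
  assumes S: "S \<in> spectrum" and c: "c \<in> S" and "c \<lhd> d"
  shows "d \<in> S"
proof -
  obtain C where C: "cap C" "\<forall>b\<in>star C c. b \<sqsubseteq> d"
    using \<open>c \<lhd> d\<close> by (auto simp: star_below_def)
  then obtain b where b: "b \<in> C" "b \<in> S"
    using spectrum_meets_cap[OF S] by blast
  then have "b \<sqsubseteq> d"
    using C(2) meets_if_common_point[OF S b(2) c] by (auto simp: star_def)
  then show ?thesis
    using spectrum_up_closed[OF S b(2)] by blast
qed

text \<open>
  Let \<open>p \<in> S - T\<close>. Regularity, applied to a cap that \<open>S\<close> meets only in \<open>p\<close>, gives \<open>c \<in> S\<close>
  with \<open>c \<lhd> p\<close>. The point \<open>T\<close> meets the cap that witnesses \<open>c \<lhd> p\<close> in an element that is not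
  below \<open>p\<close>, hence does not meet \<open>c\<close>.
\<close>

lemma Hausdorff_space_spectrum:
  assumes reg: regular_poset
  shows "Hausdorff_space spectrum_topology"
  unfolding Hausdorff_space_def topspace_spectrum_topology
proof (intro allI impI)
  fix S T
  assume ST: "S \<in> spectrum \<and> T \<in> spectrum \<and> S \<noteq> T"
  then have S: "S \<in> spectrum" and T: "T \<in> spectrum" by auto
  obtain p where p: "p \<in> S" "p \<notin> T"
    using ST spectrum_incomparable by metis
  obtain D where D: "cap D" "S \<inter> D = {p}"
    using spectrum_unique_in_cap[OF S p(1)] by blast
  obtain C where C: "cap C" "\<forall>c\<in>C. \<exists>d\<in>D. c \<lhd> d"
    using reg D(1) unfolding regular_poset_def by blast
  obtain c where c: "c \<in> C" "c \<in> S"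
    using spectrum_meets_cap[OF S C(1)] by blast
  obtain d where d: "d \<in> D" "c \<lhd> d"
    using C(2) c(1) by blast
  have "d = p"
    using star_below_point[OF S c(2) d(2)] d(1) D(2) by blast
  then obtain B where B: "cap B" "\<forall>b\<in>star B c. b \<sqsubseteq> p"
    using d(2) by (auto simp: star_below_def)
  obtain b where b: "b \<in> B" "b \<in> T"
    using spectrum_meets_cap[OF T B(1)] by blast
  have "\<not> meets b c"
    using B(2) b p(2) spectrum_up_closed[OF T b(2)] by (auto simp: star_def)
  then have "disjnt (subbasic c) (subbasic b)"
    using meets_if_common_point by (auto simp: disjnt_def subbasic_def)
  moreover have "S \<in> subbasic c" "T \<in> subbasic b"
    using S T c b by (auto simp: subbasic_def)
  moreover have "openin spectrum_topology (subbasic c)" "openin spectrum_topology (subbasic b)"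
    using c b S T spectrum_carrier openin_subbasic by blast+
  ultimately show "\<exists>U V. openin spectrum_topology U \<and> openin spectrum_topology V \<and>
      S \<in> U \<and> T \<in> V \<and> disjnt U V"
    by blast
qed

section \<open>Weakly tangled posets have hereditarily indecomposable spectra\<close>

definition touching :: "'a set \<Rightarrow> 'a set set \<Rightarrow> 'a set" where
  "touching D K = {d \<in> D. subbasic d \<inter> K \<noteq> {}}"

text \<open>
  A splitting of the elements touching \<open>K\<close> into two nonempty parts without meeting elements
  would separate \<open>K\<close> by the unions of the corresponding basic sets.
\<close>

lemma cluster_touching:
  assumes D: "cap D" and K: "connectedin spectrum_topology K"
  shows "cluster (touching D K)"
  unfolding cluster_def
proof (intro conjI allI impI)
  show "touching D K \<subseteq> P"
    using cap_subset[OF D] by (auto simp: touching_def)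
  fix A B
  assume AB: "A \<noteq> {} \<and> B \<noteq> {} \<and> A \<union> B = touching D K"
  let ?A = "\<Union>(subbasic ` A)" and ?B = "\<Union>(subbasic ` B)"
  have AP: "A \<subseteq> P" "B \<subseteq> P"
    using AB cap_subset[OF D] by (auto simp: touching_def)
  have "openin spectrum_topology ?A" "openin spectrum_topology ?B"
    using AP openin_subbasic by (auto intro!: openin_Union)
  moreover have "K \<subseteq> ?A \<union> ?B"
  proof
    fix S assume S: "S \<in> K"
    then have "S \<in> spectrum"
      using connectedin_subset_topspace[OF K] by auto
    then obtain d where "d \<in> D" "S \<in> subbasic d"
      using spectrum_meets_cap D by (auto simp: subbasic_def)
    with S have "d \<in> A \<union> B"
      using AB by (auto simp: touching_def)
    with \<open>S \<in> subbasic d\<close> show "S \<in> ?A \<union> ?B" by blast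
  qed
  moreover have "?A \<inter> K \<noteq> {}" "?B \<inter> K \<noteq> {}"
  proof -
    obtain a b where "a \<in> A" "b \<in> B" using AB by blast
    moreover from this have "a \<in> touching D K" "b \<in> touching D K" using AB by blast+
    ultimately show "?A \<inter> K \<noteq> {}" "?B \<inter> K \<noteq> {}"
      unfolding touching_def by blast+
  qed
  ultimately have "?A \<inter> ?B \<inter> K \<noteq> {}"
    using K unfolding connectedin by blast
  then obtain S a b where "a \<in> A" "b \<in> B" "S \<in> subbasic a" "S \<in> subbasic b"
    by blast
  then show "set_meets A B"
    using meets_if_common_point unfolding set_meets_def subbasic_def by blast
qed

lemma cap_separating_point:
  assumes L: "closedin spectrum_topology L" and x: "x \<in> spectrum" "x \<notin> L"
  obtains C where "cap C" "\<forall>c\<in>C. c \<in> x \<longrightarrow> subbasic c \<inter> L = {}"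
proof -
  obtain p where p: "p \<in> x" "subbasic p \<inter> L = {}"
    using spectrum_outside_closed[OF L x] by blast
  obtain C where C: "cap C" "x \<inter> C = {p}"
    using spectrum_unique_in_cap[OF x(1) p(1)] .
  show thesis
  proof (rule that[OF C(1)], intro ballI impI)
    fix c assume "c \<in> C" "c \<in> x"
    then have "c = p" using C(2) by blast
    with p(2) show "subbasic c \<inter> L = {}" by simp
  qed
qed

text \<open>
  An element of \<open>D\<close> in \<open>x\<close> touches \<open>K\<close>. Any \<open>c \<in> C\<close> above it belongs to \<open>x\<close>, hence does not
  touch \<open>L\<close>, and neither does anything below \<open>c\<close>.
\<close>

lemma not_subset_spread_touching:
  assumes D: "cap D" and x: "x \<in> spectrum" "x \<in> K"
    and C: "\<And>c. c \<in> C \<Longrightarrow> c \<in> x \<Longrightarrow> subbasic c \<inter> L = {}"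
  shows "\<not> touching D K \<subseteq> spread (touching D L) C"
proof
  assume sub: "touching D K \<subseteq> spread (touching D L) C"
  obtain p where p: "p \<in> D" "p \<in> x"
    using spectrum_meets_cap[OF x(1) D] by blast
  then have "p \<in> touching D K"
    using x by (auto simp: touching_def subbasic_def)
  then obtain d c where d: "d \<in> touching D L" and c: "c \<in> C" "d \<sqsubseteq> c" "p \<sqsubseteq> c"
    using sub by (auto simp: spread_def)
  have "subbasic c \<inter> L \<noteq> {}"
    using d subbasic_mono[OF c(2)] by (auto simp: touching_def)
  moreover have "c \<in> x"
    using spectrum_up_closed[OF x(1) p(2) c(3)] .
  ultimately show False
    using C c(1) by blast
qed

theorem hereditarily_indecomposable_if_weakly_tangled:
  assumes wt: weakly_tangled
  shows "hereditarily_indecomposable_space spectrum_topology"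
  unfolding hereditarily_indecomposable_space_iff
proof (intro allI impI, rule ccontr)
  fix K L
  assume KL: "subcontinuum spectrum_topology K \<and> subcontinuum spectrum_topology L \<and> K \<inter> L \<noteq> {}"
    and "\<not> (K \<subseteq> L \<or> L \<subseteq> K)"
  then obtain x y where xy: "x \<in> K" "x \<notin> L" "y \<in> L" "y \<notin> K" by blast
  have K: "closedin spectrum_topology K" "connectedin spectrum_topology K"
    and L: "closedin spectrum_topology L" "connectedin spectrum_topology L"
    using KL by (auto simp: subcontinuum_def)
  then have sub: "K \<subseteq> spectrum" "L \<subseteq> spectrum"
    using closedin_subset[OF K(1)] closedin_subset[OF L(1)] by auto
  have x: "x \<in> spectrum" and y: "y \<in> spectrum"
    using xy sub by auto
  obtain C1 where C1: "cap C1" "\<forall>c\<in>C1. c \<in> x \<longrightarrow> subbasic c \<inter> L = {}"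
    using cap_separating_point[OF L(1) x xy(2)] .
  obtain C2 where C2: "cap C2" "\<forall>c\<in>C2. c \<in> y \<longrightarrow> subbasic c \<inter> K = {}"
    using cap_separating_point[OF K(1) y xy(4)] .
  obtain C where C: "cap C" "refines C C1" "refines C C2"
    using common_refinement[OF C1(1) C2(1)] .
  have Cx: "subbasic c \<inter> L = {}" if c: "c \<in> C" "c \<in> x" for c
  proof -
    obtain d where "d \<in> C1" "c \<sqsubseteq> d" using C(2) c(1) by (auto simp: refines_def)
    then show ?thesis
      using C1(2) spectrum_up_closed[OF x c(2)] subbasic_mono by blast
  qed
  have Cy: "subbasic c \<inter> K = {}" if c: "c \<in> C" "c \<in> y" for c
  proof -
    obtain d where "d \<in> C2" "c \<sqsubseteq> d" using C(3) c(1) by (auto simp: refines_def)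
    then show ?thesis
      using C2(2) spectrum_up_closed[OF y c(2)] subbasic_mono by blast
  qed
  obtain D where D: "cap D" "weakly_tangled_refinement D C"
    using wt C(1) by (auto simp: weakly_tangled_def)
  obtain z where z: "z \<in> K" "z \<in> L"
    using KL by blast
  then obtain d where "d \<in> D" "z \<in> subbasic d"
    using spectrum_meets_cap[OF _ D(1)] sub unfolding subbasic_def by blast
  with z have "touching D K \<inter> touching D L \<noteq> {}"
    by (auto simp: touching_def)
  moreover have "touching D K \<subseteq> D" "touching D L \<subseteq> D"
    by (auto simp: touching_def)
  ultimately have "touching D K \<subseteq> spread (touching D L) C \<or> touching D L \<subseteq> spread (touching D K) C"
    using D(2) cluster_touching[OF D(1) K(2)] cluster_touching[OF D(1) L(2)]
    unfolding weakly_tangled_refinement_def by blast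
  then show False
    using not_subset_spread_touching[OF D(1) x xy(1) Cx] not_subset_spread_touching[OF D(1) y xy(3) Cy]
    by blast
qed

section \<open>Limits of clusters\<close>

definition limit_set :: "nat filter \<Rightarrow> (nat \<Rightarrow> 'a set) \<Rightarrow> 'a set set" where
  "limit_set U E = {S \<in> spectrum. \<forall>p\<in>S. \<forall>\<^sub>F n in U. \<exists>e\<in>E n. e \<sqsubseteq> p}"

lemma closedin_limit_set: "closedin spectrum_topology (limit_set U E)"
proof -
  have "openin spectrum_topology (spectrum - limit_set U E)"
    unfolding openin_spectrum_iff limit_set_def subbasic_def by blast
  then show ?thesis
    by (auto simp: closedin_def limit_set_def)
qed

text \<open>
  The elements that are eventually above \<open>e n\<close> form a selector, since each cap contains a
  finite cap and an ultrafilter picks one of its finitely many elements.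
\<close>

lemma limit_point:
  assumes U: "ultrafilter U" and fine: "\<And>C. cap C \<Longrightarrow> \<forall>\<^sub>F n in U. \<exists>c\<in>C. e n \<sqsubseteq> c"
  shows "\<exists>x\<in>spectrum. \<forall>p\<in>x. \<forall>\<^sub>F n in U. e n \<sqsubseteq> p"
proof -
  let ?S = "{p \<in> P. \<forall>\<^sub>F n in U. e n \<sqsubseteq> p}"
  have "?S \<inter> C \<noteq> {}" if C: "cap C" for C
  proof -
    obtain D where D: "D \<subseteq> C" "finite D" "cap D"
      by (rule finite_subcap[OF C])
    then obtain d where "d \<in> D" "\<forall>\<^sub>F n in U. e n \<sqsubseteq> d"
      using ultrafilter_bex_finite[OF U D(2) fine[OF D(3)]] by blast
    with D(1) cap_subset[OF C] show ?thesis by blast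
  qed
  then have "selector ?S"
    by (auto simp: selector_def)
  then obtain x where "x \<in> spectrum" "x \<subseteq> ?S"
    by (rule selector_contains_minimal)
  then show ?thesis by blast
qed

lemma limit_point_in_limit_set:
  assumes x: "x \<in> spectrum" "\<forall>p\<in>x. \<forall>\<^sub>F n in U. e n \<sqsubseteq> p" and e: "\<forall>\<^sub>F n in U. e n \<in> E n"
  shows "x \<in> limit_set U E"
proof -
  have "\<forall>\<^sub>F n in U. \<exists>a\<in>E n. a \<sqsubseteq> p" if "p \<in> x" for p
    using x(2)[rule_format, OF that] e by eventually_elim blast
  with x(1) show ?thesis
    by (simp add: limit_set_def)
qed

text \<open>
  If the limit were separated by disjoint open sets \<open>V\<close> and \<open>W\<close>, then the spectrum would be
  covered by basic sets inside \<open>V\<close>, basic sets inside \<open>W\<close> and basic sets \<open>p\<^sup>\<in>\<close> such that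
  eventually no element of \<open>E n\<close> is below \<open>p\<close>. Finitely many of them suffice, so for some \<open>n\<close>
  every element of \<open>E n\<close> is inside \<open>V\<close> or inside \<open>W\<close>, and both possibilities occur. By primeness,
  elements inside \<open>V\<close> do not meet elements inside \<open>W\<close>, and \<open>E n\<close> is not a cluster.
\<close>

lemma connectedin_limit_set:
  assumes reg: regular_poset and pr: prime_poset and U: "ultrafilter U"
    and fine: "\<And>C. cap C \<Longrightarrow> \<forall>\<^sub>F n in U. refines (E n) C"
    and clus: "\<forall>\<^sub>F n in U. cluster (E n)"
  shows "connectedin spectrum_topology (limit_set U E)"
proof -
  let ?K = "limit_set U E"
  have normal: "normal_space spectrum_topology"
    using compact_Hausdorff_or_regular_imp_normal_space compact_space_spectrum
      Hausdorff_space_spectrum[OF reg] by blast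
  have False
    if cl: "closedin spectrum_topology A" "closedin spectrum_topology B"
      and cov: "?K \<subseteq> A \<union> B" and dis: "A \<inter> B \<inter> ?K = {}"
      and neA: "A \<inter> ?K \<noteq> {}" and neB: "B \<inter> ?K \<noteq> {}" for A B
  proof -
    have "closedin spectrum_topology (A \<inter> ?K)" "closedin spectrum_topology (B \<inter> ?K)"
      using cl closedin_limit_set by (auto intro: closedin_Int)
    moreover have "disjnt (A \<inter> ?K) (B \<inter> ?K)"
      using dis by (auto simp: disjnt_def)
    ultimately obtain V W where V: "openin spectrum_topology V" "A \<inter> ?K \<subseteq> V"
      and W: "openin spectrum_topology W" "B \<inter> ?K \<subseteq> W" and VW: "disjnt V W"
      using normal unfolding normal_space_def by metis
    let ?C = "{p \<in> P. subbasic p \<subseteq> V \<or> subbasic p \<subseteq> W \<or> (\<forall>\<^sub>F n in U. \<not> (\<exists>e\<in>E n. e \<sqsubseteq> p))}"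
    have "\<exists>p\<in>?C. p \<in> S" if S: "S \<in> spectrum" for S
    proof -
      consider "S \<in> V" | "S \<in> W" | "S \<notin> ?K"
        using cov V W by blast
      then obtain p where "p \<in> S"
        "subbasic p \<subseteq> V \<or> subbasic p \<subseteq> W \<or> (\<forall>\<^sub>F n in U. \<not> (\<exists>e\<in>E n. e \<sqsubseteq> p))"
      proof cases
        case 3
        then obtain p where "p \<in> S" "\<not> (\<forall>\<^sub>F n in U. \<exists>e\<in>E n. e \<sqsubseteq> p)"
          using S by (auto simp: limit_set_def)
        with that ultrafilter_not_eventually[OF U] show thesis by blast
      qed (use V(1) W(1) that openin_spectrum_iff in blast)+
      then show ?thesis
        using spectrum_carrier[OF S] by blast
    qed
    then have "cap ?C"
      by (simp add: cap_iff_covers)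
    then obtain D where D: "D \<subseteq> ?C" "finite D" "cap D"
      by (rule finite_subcap)
    \<comment> \<open>the basic sets of these elements are disjoint from the limit set\<close>
    let ?D0 = "{d \<in> D. \<forall>\<^sub>F n in U. \<not> (\<exists>e\<in>E n. e \<sqsubseteq> d)}"
    have "\<forall>\<^sub>F n in U. \<forall>d\<in>?D0. \<not> (\<exists>e\<in>E n. e \<sqsubseteq> d)"
      using D(2) by (intro eventually_ball_finite) auto
    moreover obtain a where a: "subbasic a \<subseteq> V" "\<forall>\<^sub>F n in U. \<exists>e\<in>E n. e \<sqsubseteq> a"
    proof -
      obtain S where "S \<in> ?K" "S \<in> V" using neA V(2) by blast
      with that V(1) show thesis
        unfolding openin_spectrum_iff limit_set_def by blast
    qed
    moreover obtain b where b: "subbasic b \<subseteq> W" "\<forall>\<^sub>F n in U. \<exists>e\<in>E n. e \<sqsubseteq> b"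
    proof -
      obtain S where "S \<in> ?K" "S \<in> W" using neB W(2) by blast
      with that W(1) show thesis
        unfolding openin_spectrum_iff limit_set_def by blast
    qed
    ultimately have ev: "\<forall>\<^sub>F n in U. (\<forall>d\<in>?D0. \<not> (\<exists>e\<in>E n. e \<sqsubseteq> d)) \<and> (\<exists>e\<in>E n. e \<sqsubseteq> a) \<and>
        (\<exists>e\<in>E n. e \<sqsubseteq> b) \<and> refines (E n) D \<and> cluster (E n)"
      using clus fine[OF D(3)] by (simp only: eventually_conj_iff simp_thms)
    have "U \<noteq> bot"
      using U by (simp add: ultrafilter_def)
    then obtain n where n: "\<forall>d\<in>?D0. \<not> (\<exists>e\<in>E n. e \<sqsubseteq> d)" "\<exists>e\<in>E n. e \<sqsubseteq> a" "\<exists>e\<in>E n. e \<sqsubseteq> b"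
        "refines (E n) D" "cluster (E n)"
      using eventually_happens'[OF _ ev] by auto
    let ?V = "{e \<in> E n. subbasic e \<subseteq> V}" and ?W = "{e \<in> E n. subbasic e \<subseteq> W}"
    have "e \<in> ?V \<union> ?W" if e: "e \<in> E n" for e
    proof -
      obtain d where d: "d \<in> D" "e \<sqsubseteq> d"
        using n(4) e by (auto simp: refines_def)
      then have "d \<notin> ?D0"
        using n(1) e by blast
      then have "subbasic d \<subseteq> V \<or> subbasic d \<subseteq> W"
        using d(1) D(1) by blast
      then show ?thesis
        using e subbasic_mono[OF d(2)] by blast
    qed
    then have "?V \<union> ?W = E n" by blast
    moreover have "?V \<noteq> {}"
      using n(2) a(1) subbasic_mono by blast
    moreover have "?W \<noteq> {}"
      using n(3) b(1) subbasic_mono by blast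
    ultimately have "set_meets ?V ?W"
      using n(5)[unfolded cluster_def, THEN conjunct2, rule_format, of ?V ?W] by simp
    then obtain v w r where "subbasic v \<subseteq> V" "subbasic w \<subseteq> W" "r \<in> P" "r \<sqsubseteq> v" "r \<sqsubseteq> w"
      by (auto simp: set_meets_def meets_def)
    then have "subbasic r \<subseteq> V \<inter> W"
      using subbasic_mono by blast
    moreover have "subbasic r \<noteq> {}"
      using pr \<open>r \<in> P\<close> by (auto simp: prime_poset_def subbasic_def spectrum_def)
    ultimately show False
      using VW by (auto simp: disjnt_def)
  qed
  then show ?thesis
    unfolding connectedin_closedin by (auto simp: limit_set_def)
qed

text \<open>
  A cap \<open>C\<close> keeps the limit of the \<open>e n\<close> away from the limit set of \<open>F\<close>: an element of \<open>C\<close> in a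
  common point would be above \<open>e n\<close> and above some element of \<open>F n\<close>.
\<close>

lemma limit_point_outside:
  assumes U: "ultrafilter U" and C: "cap C"
    and x: "x \<in> spectrum" "\<forall>p\<in>x. \<forall>\<^sub>F n in U. e n \<sqsubseteq> p"
    and far: "\<forall>\<^sub>F n in U. e n \<notin> spread (F n) C"
  shows "x \<notin> limit_set U F"
proof
  assume "x \<in> limit_set U F"
  moreover obtain c where c: "c \<in> C" "c \<in> x"
    using spectrum_meets_cap[OF x(1) C] by blast
  ultimately have "\<forall>\<^sub>F n in U. \<exists>f\<in>F n. f \<sqsubseteq> c"
    by (auto simp: limit_set_def)
  with x(2)[rule_format, OF c(2)] far have "\<forall>\<^sub>F n in U. False"
  proof eventually_elim
    case (elim n)
    then show ?case
      using c(1) le_carrier unfolding spread_def by blast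
  qed
  with U show False
    by (simp add: ultrafilter_def)
qed

theorem weakly_tangled_if_hereditarily_indecomposable:
  assumes reg: regular_poset and pr: prime_poset
    and hi: "hereditarily_indecomposable_space spectrum_topology"
  shows weakly_tangled
proof (rule ccontr)
  assume "\<not> weakly_tangled"
  then obtain C where C: "cap C" and none: "\<And>D. cap D \<Longrightarrow> \<not> weakly_tangled_refinement D C"
    by (auto simp: weakly_tangled_def)
  obtain k where k: "\<And>n. n \<ge> k \<Longrightarrow> refines (level n) C"
    using cap_refined_by_levels[OF C] by blast
  have "\<exists>E F e f g. n \<ge> k \<longrightarrow> cluster E \<and> cluster F \<and> E \<subseteq> level n \<and> F \<subseteq> level n \<and>
      g \<in> E \<and> g \<in> F \<and> e \<in> E \<and> e \<notin> spread F C \<and> f \<in> F \<and> f \<notin> spread E C" for n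
    using none[OF cap_level[of n]] k[of n] cap_subset[OF C] level_carrier[of n]
    unfolding weakly_tangled_refinement_def by blast
  then obtain E F e f g where EF: "\<And>n. n \<ge> k \<Longrightarrow> cluster (E n) \<and> cluster (F n) \<and>
      E n \<subseteq> level n \<and> F n \<subseteq> level n \<and> g n \<in> E n \<and> g n \<in> F n \<and>
      e n \<in> E n \<and> e n \<notin> spread (F n) C \<and> f n \<in> F n \<and> f n \<notin> spread (E n) C"
    by metis
  obtain U :: "nat filter" where U: "ultrafilter U" and "U \<le> sequentially"
    using ultrafilter_exists[of sequentially] by auto
  have ev: "\<forall>\<^sub>F n in U. Q n" if "\<And>n. n \<ge> m \<Longrightarrow> Q n" for Q m
    by (rule filter_leD[OF \<open>U \<le> sequentially\<close>]) (use that in \<open>auto simp: eventually_sequentially\<close>)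
  have evk: "\<forall>\<^sub>F n in U. k \<le> n"
    by (rule ev)
  have fine: "\<forall>\<^sub>F n in U. refines (level n) D" if D: "cap D" for D
  proof -
    obtain m where "\<And>n. n \<ge> m \<Longrightarrow> refines (level n) D"
      using cap_refined_by_levels[OF D] by blast
    then show ?thesis by (rule ev)
  qed
  have fineE: "\<forall>\<^sub>F n in U. refines (E n) D" and fineF: "\<forall>\<^sub>F n in U. refines (F n) D"
    if D: "cap D" for D
    using fine[OF D] evk by (eventually_elim, meson EF refines_def subsetD)+
  have mem: "\<forall>\<^sub>F n in U. e n \<in> E n" "\<forall>\<^sub>F n in U. f n \<in> F n" "\<forall>\<^sub>F n in U. g n \<in> E n" "\<forall>\<^sub>F n in U. g n \<in> F n"
    and far: "\<forall>\<^sub>F n in U. e n \<notin> spread (F n) C" "\<forall>\<^sub>F n in U. f n \<notin> spread (E n) C"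
    using EF by (auto intro: ev[of k])
  have limit: "\<exists>x\<in>spectrum. \<forall>p\<in>x. \<forall>\<^sub>F n in U. h n \<sqsubseteq> p"
    if h: "\<forall>\<^sub>F n in U. h n \<in> G n" and G: "\<And>D. cap D \<Longrightarrow> \<forall>\<^sub>F n in U. refines (G n) D" for h G
  proof (rule limit_point[OF U])
    fix D assume D: "cap D"
    show "\<forall>\<^sub>F n in U. \<exists>d\<in>D. h n \<sqsubseteq> d"
      using G[OF D] h by eventually_elim (simp add: refines_def)
  qed
  let ?K = "limit_set U E" and ?L = "limit_set U F"
  have "\<forall>\<^sub>F n in U. cluster (E n)" "\<forall>\<^sub>F n in U. cluster (F n)"
    using EF by (auto intro: ev[of k])
  then have "connectedin spectrum_topology ?K" "connectedin spectrum_topology ?L"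
    using connectedin_limit_set[OF reg pr U] fineE fineF by blast+
  then have "subcontinuum spectrum_topology ?K" "subcontinuum spectrum_topology ?L"
    by (auto simp: subcontinuum_def closedin_limit_set)
  moreover have "?K \<inter> ?L \<noteq> {}"
  proof -
    obtain z where "z \<in> spectrum" "\<forall>p\<in>z. \<forall>\<^sub>F n in U. g n \<sqsubseteq> p"
      using limit[OF mem(3) fineE] by blast
    then have "z \<in> ?K" "z \<in> ?L"
      using mem(3,4) by (auto intro: limit_point_in_limit_set)
    then show ?thesis by blast
  qed
  moreover have "\<not> ?K \<subseteq> ?L"
  proof -
    obtain x where x: "x \<in> spectrum" "\<forall>p\<in>x. \<forall>\<^sub>F n in U. e n \<sqsubseteq> p"
      using limit[OF mem(1) fineE] by blast
    show ?thesis
      using limit_point_in_limit_set[OF x mem(1)] limit_point_outside[OF U C x far(1)] by blast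
  qed
  moreover have "\<not> ?L \<subseteq> ?K"
  proof -
    obtain y where y: "y \<in> spectrum" "\<forall>p\<in>y. \<forall>\<^sub>F n in U. f n \<sqsubseteq> p"
      using limit[OF mem(2) fineF] by blast
    show ?thesis
      using limit_point_in_limit_set[OF y mem(2)] limit_point_outside[OF U C y far(2)] by blast
  qed
  ultimately show False
    using hi unfolding hereditarily_indecomposable_space_iff by blast
qed

end

theorem theorem2p52:
  fixes P :: "'a set" and R :: "'a rel"
  assumes "omega_poset P R"
  shows "(poset.weakly_tangled P R \<longrightarrow>
            hereditarily_indecomposable_space (poset.spectrum_topology P R)) \<and>
         (poset.regular_poset P R \<and> poset.prime_poset P R \<and>
            hereditarily_indecomposable_space (poset.spectrum_topology P R) \<longrightarrow>
            poset.weakly_tangled P R)"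
proof -
  interpret omega_poset P R by fact
  show ?thesis
    using hereditarily_indecomposable_if_weakly_tangled
      weakly_tangled_if_hereditarily_indecomposable by blast
qed

end
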